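(* Let $X$ be a topological space, let $\Bbbk$ be a field, and let $a, b \in H^*(X;\Bbbk)$ be homogeneous cohomology classes of degrees $|a|$ and $|b|$. For $n \geq 2$ we have $$(b_1-b_2)(a_1-a_2)(a_1-a_3) \cdots (a_1-a_n) \equiv (-1)^{n+1}\bigl(b\otimes a + (-1)^{|a||b|}a \otimes b\bigr)\otimes a \otimes \cdots \otimes a$$ modulo terms in the ideal of $H^*(X;\Bbbk)^{\otimes n}$ generated by the elements $a^2 \otimes 1 \otimes \cdots \otimes 1$, $ba \otimes 1 \otimes \cdots \otimes 1$, and $1 \otimes ba \otimes 1 \otimes \cdots \otimes 1$.
   Context: $H^*(X;\Bbbk)$ is the cohomology ring of $X$ with coefficients in $\Bbbk$, a graded-commutative $\Bbbk$-algebra under cup product. $H^*(X;\Bbbk)^{\otimes n}$ denotes the $n$-fold tensor product of $H^*(X;\Bbbk)$ over $\Bbbk$, equipped with the graded product, determined on homogeneous elements by the Koszul sign rule: $(x_1 \otimes \cdots \otimes x_n)(y_1 \otimes \cdots \otimes y_n) = (-1)^{\sum_{i>j} |x_i||y_j|}\, x_1y_1 \otimes \cdots \otimes x_ny_n$. For $a \in H^*(X;\Bbbk)$ and $1 \le i \le n$, $a_i$ denotes the element $1 \otimes \cdots \otimes 1 \otimes a \otimes 1 \otimes \cdots \otimes 1$ of $H^*(X;\Bbbk)^{\otimes n}$ with $a$ in the $i$-th position; similarly for $b_i$. Thus $a_ib_j = (-1)^{|a||b|} b_j a_i$ for $i \neq j$. In the right-hand side of the congruence, the factor in parentheses occupies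 the first two tensor positions and the remaining $n-2$ positions are all $a$ (for $n=2$ there are no remaining positions). All displayed generators of the ideal are elements of $H^*(X;\Bbbk)^{\otimes n}$, with the entries not shown equal to $1$. *)

theory Defs
  imports "HOL-Homology.Homology" "HOL-Algebra.QuotRing" "HOL-Library.Poly_Mapping" "HOL-Library.Set_Algebras"
begin

section \<open>The singular cohomology ring with field coefficients\<close>

text \<open>
  Singular simplices and their faces are those of the library.  A cochain is a family
  \<open>c p \<sigma>\<close> indexed by a degree \<open>p\<close> and a singular \<open>p\<close>-simplex \<open>\<sigma>\<close>, with only finitely many nonzero
  components \<open>c p\<close>, i.e. an element of the direct sum over \<open>p\<close> of the groups \<open>C\<^sup>p(X;k)\<close>.
  Since HOL functions are total, \<open>c p\<close> is made to vanish off the singular \<open>p\<close>-simplices.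
\<close>

type_synonym ('a, 'k) cochain = "nat \<Rightarrow> ((nat \<Rightarrow> real) \<Rightarrow> 'a) \<Rightarrow> 'k"

definition cochains :: "'a topology \<Rightarrow> ('a, 'k::field) cochain set" where
  "cochains X = {c. (\<forall>p \<sigma>. \<not> singular_simplex p X \<sigma> \<longrightarrow> c p \<sigma> = 0) \<and> finite {p. c p \<noteq> (\<lambda>\<sigma>. 0)}}"

definition coboundary :: "'a topology \<Rightarrow> ('a, 'k::field) cochain \<Rightarrow> ('a, 'k) cochain" where
  "coboundary X c = (\<lambda>p \<sigma>.
     if p = 0 \<or> \<not> singular_simplex p X \<sigma> then 0
     else \<Sum>k\<le>p. (-1) ^ k * c (p - 1) (singular_face p k \<sigma>))"

text \<open>
  The library's standard simplex of dimension \<open>p\<close> consists of points of \<open>nat \<Rightarrow> real\<close> that are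
  supported on \<open>{0..p}\<close>.  Hence the front \<open>q\<close>-face is a mere restriction, and the back
  \<open>r\<close>-face of a \<open>p\<close>-simplex is obtained by shifting barycentric coordinates by \<open>p - r\<close>.
\<close>

definition front_face :: "nat \<Rightarrow> ((nat \<Rightarrow> real) \<Rightarrow> 'a) \<Rightarrow> (nat \<Rightarrow> real) \<Rightarrow> 'a" where
  "front_face q \<sigma> = restrict \<sigma> (standard_simplex q)"

definition back_face :: "nat \<Rightarrow> nat \<Rightarrow> ((nat \<Rightarrow> real) \<Rightarrow> 'a) \<Rightarrow> (nat \<Rightarrow> real) \<Rightarrow> 'a" where
  "back_face p r \<sigma> =
     restrict (\<lambda>x. \<sigma> (\<lambda>i. if i < p - r then 0 else x (i - (p - r)))) (standard_simplex r)"

definition cup :: "'a topology \<Rightarrow> ('a, 'k::field) cochain \<Rightarrow> ('a, 'k) cochain \<Rightarrow> ('a, 'k) cochain" where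
  "cup X c d = (\<lambda>p \<sigma>.
     if singular_simplex p X \<sigma>
     then \<Sum>q\<le>p. c q (front_face q \<sigma>) * d (p - q) (back_face p (p - q) \<sigma>)
     else 0)"

definition cocycles :: "'a topology \<Rightarrow> ('a, 'k::field) cochain set" where
  "cocycles X = {c \<in> cochains X. coboundary X c = (\<lambda>p \<sigma>. 0)}"

definition coboundaries :: "'a topology \<Rightarrow> ('a, 'k::field) cochain set" where
  "coboundaries X = coboundary X ` cochains X"

definition cocycle_algebra :: "'a topology \<Rightarrow> ('k::field, ('a, 'k) cochain) module" where
  "cocycle_algebra X =
     \<lparr>carrier = cocycles X,
      mult = cup X,
      one = (\<lambda>p \<sigma>. if p = 0 \<and> singular_simplex 0 X \<sigma> then 1 else 0),
      zero = (\<lambda>p \<sigma>. 0),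
      add = (\<lambda>c d p \<sigma>. c p \<sigma> + d p \<sigma>),
      smult = (\<lambda>k c p \<sigma>. k * c p \<sigma>)\<rparr>"

text \<open>
  All degrees are treated at once: the coboundary operator is homogeneous, so cocycles modulo
  coboundaries of the total complex is the direct sum of the \<open>H\<^sup>p(X;k)\<close>.  The library's quotient
  ring has no scalar multiplication, which is therefore added as a record extension.
\<close>

definition cohomology_algebra ::
    "'a topology \<Rightarrow> ('k::field, ('a, 'k) cochain set) module" where
  "cohomology_algebra X =
     ring.extend (cocycle_algebra X Quot coboundaries X)
       (module.fields
         (\<lambda>k A. \<Union>z\<in>A. coboundaries X +>\<^bsub>cocycle_algebra X\<^esub> (k \<odot>\<^bsub>cocycle_algebra X\<^esub> z)))"

definition cohomology :: "'a topology \<Rightarrow> nat \<Rightarrow> ('a, 'k::field) cochain set set" where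
  "cohomology X p =
     {coboundaries X +>\<^bsub>cocycle_algebra X\<^esub> z |z.
        z \<in> cocycles X \<and> (\<forall>q. q \<noteq> p \<longrightarrow> z q = (\<lambda>\<sigma>. 0))}"

section \<open>Tensor powers of a graded algebra, with the Koszul product\<close>

text \<open>
  Below, \<open>A\<close> is an algebra over the field \<open>'k\<close> and \<open>G p\<close> is its homogeneous part of degree \<open>p\<close>.
  The \<open>n\<close>-th tensor power of \<open>A\<close> is the free vector space on the \<open>n\<close>-tuples of
  elements of \<open>A\<close> modulo the subspace spanned by the multilinearity relations; its elements are
  the cosets of that subspace.
\<close>

abbreviation fscale :: "'k::field \<Rightarrow> ('b \<Rightarrow>\<^sub>0 'k) \<Rightarrow> ('b \<Rightarrow>\<^sub>0 'k)" where
  "fscale k \<equiv> Poly_Mapping.map ((*) k)"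

abbreviation fbasis :: "'b \<Rightarrow> ('b \<Rightarrow>\<^sub>0 'k::field)" where
  "fbasis x \<equiv> Poly_Mapping.single x 1"

definition tuples :: "('k, 'h, 'm) module_scheme \<Rightarrow> nat \<Rightarrow> 'h list set" where
  "tuples A n = {xs. length xs = n \<and> set xs \<subseteq> carrier A}"

definition tensor_relations :: "('k::field, 'h, 'm) module_scheme \<Rightarrow> nat \<Rightarrow> ('h list \<Rightarrow>\<^sub>0 'k) set" where
  "tensor_relations A n = Modules.module.span fscale
     ({fbasis (xs[i := x \<oplus>\<^bsub>A\<^esub> y]) - fbasis (xs[i := x]) - fbasis (xs[i := y]) |xs i x y.
         xs \<in> tuples A n \<and> i < n \<and> x \<in> carrier A \<and> y \<in> carrier A} \<union>
      {fbasis (xs[i := k \<odot>\<^bsub>A\<^esub> x]) - fscale k (fbasis (xs[i := x])) |xs i k x.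
         xs \<in> tuples A n \<and> i < n \<and> x \<in> carrier A})"

definition tensor_class ::
    "('k::field, 'h, 'm) module_scheme \<Rightarrow> nat \<Rightarrow> ('h list \<Rightarrow>\<^sub>0 'k) \<Rightarrow> ('h list \<Rightarrow>\<^sub>0 'k) set" where
  "tensor_class A n f = f +o tensor_relations A n"

definition homogeneous_tuples :: "(nat \<Rightarrow> 'h set) \<Rightarrow> nat \<Rightarrow> 'h list set" where
  "homogeneous_tuples G n = {xs. length xs = n \<and> (\<forall>x\<in>set xs. \<exists>p. x \<in> G p)}"

text \<open>
  A nonzero homogeneous element lies in just one \<open>G p\<close>.  Zero gets degree 0, which is immaterial:
  tuples having a zero entry are tensor relations.
\<close>

definition hdegree :: "(nat \<Rightarrow> 'h set) \<Rightarrow> 'h \<Rightarrow> nat" where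
  "hdegree G x = (LEAST p. x \<in> G p)"

definition koszul_sign :: "(nat \<Rightarrow> 'h set) \<Rightarrow> 'h list \<Rightarrow> 'h list \<Rightarrow> 'k::field" where
  "koszul_sign G xs ys = (-1) ^ (\<Sum>i<length xs. \<Sum>j<i. hdegree G (xs ! i) * hdegree G (ys ! j))"

definition koszul_mult ::
    "('k::field, 'h, 'm) module_scheme \<Rightarrow> (nat \<Rightarrow> 'h set) \<Rightarrow>
     ('h list \<Rightarrow>\<^sub>0 'k) \<Rightarrow> ('h list \<Rightarrow>\<^sub>0 'k) \<Rightarrow> ('h list \<Rightarrow>\<^sub>0 'k)" where
  "koszul_mult A G f g =
     (\<Sum>xs\<in>Poly_Mapping.keys f. \<Sum>ys\<in>Poly_Mapping.keys g.
        fscale (Poly_Mapping.lookup f xs * Poly_Mapping.lookup g ys * koszul_sign G xs ys)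
          (fbasis (map2 (mult A) xs ys)))"

text \<open>
  The Koszul rule prescribes the product on tuples of homogeneous elements only, so two classes are
  multiplied through representatives that are combinations of such tuples.  Every class has such
  representatives, and the product does not depend on their choice.
\<close>

definition tensor_power ::
    "('k::field, 'h, 'm) module_scheme \<Rightarrow> (nat \<Rightarrow> 'h set) \<Rightarrow> nat \<Rightarrow>
     ('k, ('h list \<Rightarrow>\<^sub>0 'k) set) module" where
  "tensor_power A G n =
     \<lparr>carrier = tensor_class A n ` {f. Poly_Mapping.keys f \<subseteq> tuples A n},
      mult = (\<lambda>S T.
        \<Union>f\<in>{f \<in> S. Poly_Mapping.keys f \<subseteq> homogeneous_tuples G n}.
        \<Union>g\<in>{g \<in> T. Poly_Mapping.keys g \<subseteq> homogeneous_tuples G n}.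
          tensor_class A n (koszul_mult A G f g)),
      one = tensor_class A n (fbasis (replicate n \<one>\<^bsub>A\<^esub>)),
      zero = tensor_class A n 0,
      add = (\<lambda>S T. S + T),
      smult = (\<lambda>k S. \<Union>f\<in>S. tensor_class A n (fscale k f))\<rparr>"

definition pure_tensor ::
    "('k::field, 'h, 'm) module_scheme \<Rightarrow> 'h list \<Rightarrow> ('h list \<Rightarrow>\<^sub>0 'k) set" where
  "pure_tensor A xs = tensor_class A (length xs) (fbasis xs)"

text \<open>\<open>1 \<otimes> \<dots> \<otimes> 1 \<otimes> x \<otimes> 1 \<otimes> \<dots> \<otimes> 1\<close> with \<open>n\<close> factors and \<open>x\<close> in position \<open>i\<close>, counted from 1\<close>

definition in_position ::
    "('k::field, 'h, 'm) module_scheme \<Rightarrow> nat \<Rightarrow> nat \<Rightarrow> 'h \<Rightarrow> ('h list \<Rightarrow>\<^sub>0 'k) set" where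
  "in_position A n i x = pure_tensor A (map (\<lambda>j. if j = i then x else \<one>\<^bsub>A\<^esub>) [1..<n + 1])"

abbreviation cohomology_tensor_power ::
    "'a topology \<Rightarrow> nat \<Rightarrow> ('k::field, (('a, 'k) cochain set list \<Rightarrow>\<^sub>0 'k) set) module" where
  "cohomology_tensor_power X n \<equiv> tensor_power (cohomology_algebra X) (cohomology X) n"

end

theory Submission
  imports Defs "HOL-Library.Function_Algebras"
begin

text \<open>
  Expand the product from the left. The factor \<open>(b\<^sub>1 - b\<^sub>2)(a\<^sub>1 - a\<^sub>2)\<close> is
  \<open>- b \<otimes> a - (-1)\<^bsup>|a||b|\<^esup> a \<otimes> b\<close> up to \<open>ba \<otimes> 1\<close> and \<open>1 \<otimes> ba\<close>. Both summands have \<open>a\<close> or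
  \<open>b\<close> in the first slot, so in each further factor \<open>a\<^sub>1 - a\<^sub>m\<close> the term \<open>a\<^sub>1\<close> lands in the ideal, and
  \<open>- a\<^sub>m\<close> changes the sign and puts \<open>a\<close> into slot \<open>m\<close>.

  Membership in the generated ideal concerns all ideals \<open>J\<close> containing the generators, and
  \<open>ideal J T\<close> includes that \<open>T\<close> is a ring. So the products on \<open>T\<close> and, through its
  first slot, on cohomology are closed. Both are defined as unions of cosets over all
  representatives; a union of cosets that is one coset equals each of them, hence these products can
  be computed on any representatives.
\<close>

section \<open>Cosets of an additive subgroup\<close>

text \<open>Products of classes are defined by double unions over representatives; as a union over
  pairs they fit \<open>Union_cosets_eq\<close>.\<close>

lemma UN_UN_Times: "(\<Union>x\<in>F. \<Union>y\<in>H. h x y) = (\<Union>z\<in>F \<times> H. h (fst z) (snd z))"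
  by force

text \<open>Both quotients are treated by this locale: \<open>R\<close> becomes the tensor relations
  in one case and the coboundaries in the other.\<close>

locale additive_cosets =
  fixes R :: "'g::ab_group_add set"
  assumes zero_mem: "0 \<in> R"
    and diff_mem: "x \<in> R \<Longrightarrow> y \<in> R \<Longrightarrow> x - y \<in> R"
begin

lemma uminus_mem: "x \<in> R \<Longrightarrow> - x \<in> R"
  using diff_mem[OF zero_mem] by simp

lemma add_mem: "x \<in> R \<Longrightarrow> y \<in> R \<Longrightarrow> x + y \<in> R"
  using diff_mem[of x "- y"] uminus_mem by simp

lemma mem_coset_iff: "x \<in> f +o R \<longleftrightarrow> x - f \<in> R"
proof
  assume "x - f \<in> R"
  then have "f + (x - f) \<in> f +o R" by (rule set_plus_intro2)
  then show "x \<in> f +o R" by simp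
qed (auto simp: elt_set_plus_def)

lemma self_mem_coset: "f \<in> f +o R"
  by (simp add: mem_coset_iff zero_mem)

lemma coset_eq_iff: "f +o R = g +o R \<longleftrightarrow> f - g \<in> R"
proof
  assume "f +o R = g +o R"
  then show "f - g \<in> R" using self_mem_coset mem_coset_iff by blast
next
  assume d: "f - g \<in> R"
  have "x - f \<in> R \<longleftrightarrow> x - g \<in> R" for x
    using add_mem[OF _ d, of "x - f"] diff_mem[OF _ d, of "x - g"] by auto
  then show "f +o R = g +o R" by (auto simp: mem_coset_iff)
qed

lemma coset_zero: "0 +o R = R"
  by (auto simp: mem_coset_iff)

lemma coset_add: "(f +o R) + (g +o R) = (f + g) +o R"
proof -
  have "R + R = R"
    using add_mem zero_mem by (force simp: set_plus_def)
  then show ?thesis by (simp add: set_plus_rearrange)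
qed

text \<open>Each \<open>h j\<close> lies in the union, hence in \<open>c +o R\<close>, and any
  element of a coset determines it. In the applications \<open>c\<close> comes from closure of a
  multiplication.\<close>

lemma Union_cosets_eq:
  assumes "(\<Union>j\<in>J. h j +o R) = c +o R" and "j \<in> J"
  shows "(\<Union>j\<in>J. h j +o R) = h j +o R"
proof -
  have "h j \<in> c +o R" using assms self_mem_coset by blast
  then have "h j +o R = c +o R" by (simp add: coset_eq_iff mem_coset_iff)
  then show ?thesis using assms(1) by simp
qed

text \<open>This serves scalar multiplication, where compatibility of \<phi> with the subgroup can
  be checked directly.\<close>

lemma Union_image_coset:
  assumes "\<And>x y. x - y \<in> R \<Longrightarrow> \<phi> x - \<phi> y \<in> R"
  shows "(\<Union>x\<in>f +o R. \<phi> x +o R) = \<phi> f +o R"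
proof -
  have "\<phi> x +o R = \<phi> f +o R" if "x \<in> f +o R" for x
    using assms that by (simp add: coset_eq_iff mem_coset_iff)
  then show ?thesis using self_mem_coset by blast
qed

end

section \<open>Congruences in rings\<close>

text \<open>Start of the expansion: the two products with equal indices vanish modulo the ideal, and
  the mixed ones enter with a minus sign. Naming their negatives \<open>y\<close> and
  \<open>z\<close> turns the remainder into a plain sum.\<close>

lemma (in ideal) mult_differences_cong:
  assumes c: "b1 \<in> carrier R" "b2 \<in> carrier R" "a1 \<in> carrier R" "a2 \<in> carrier R"
      "y \<in> carrier R" "z \<in> carrier R"
    and mem: "b1 \<otimes> a1 \<in> I" "b2 \<otimes> a2 \<in> I"
    and eq: "b1 \<otimes> a2 = \<ominus> y" "b2 \<otimes> a1 = \<ominus> z"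
  shows "(b1 \<ominus> b2) \<otimes> (a1 \<ominus> a2) \<ominus> (y \<oplus> z) \<in> I"
proof -
  have "(b1 \<ominus> b2) \<otimes> (a1 \<ominus> a2) = b1 \<otimes> a1 \<oplus> b2 \<otimes> a2 \<oplus> (y \<oplus> z)"
    using c eq by (simp add: minus_eq l_distr r_distr l_minus r_minus minus_add a_ac)
  moreover have "b1 \<otimes> a1 \<oplus> b2 \<otimes> a2 \<oplus> (y \<oplus> z) \<ominus> (y \<oplus> z) = b1 \<otimes> a1 \<oplus> b2 \<otimes> a2"
    using c by (simp add: minus_eq a_assoc r_neg)
  ultimately show ?thesis
    using mem by (simp add: a_closed)
qed

text \<open>Split \<open>x\<close> into \<open>x - (u + v)\<close> and \<open>u + v\<close>. The
  first part stays in the ideal after multiplication; in the second only the products with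
  \<open>a2\<close> survive.\<close>

lemma (in ideal) mult_difference_step:
  assumes c: "x \<in> carrier R" "u \<in> carrier R" "v \<in> carrier R" "a1 \<in> carrier R" "a2 \<in> carrier R"
      "y \<in> carrier R" "z \<in> carrier R"
    and mem: "x \<ominus> (u \<oplus> v) \<in> I" "u \<otimes> a1 \<in> I" "v \<otimes> a1 \<in> I"
    and eq: "u \<otimes> a2 = \<ominus> y" "v \<otimes> a2 = \<ominus> z"
  shows "x \<otimes> (a1 \<ominus> a2) \<ominus> (y \<oplus> z) \<in> I"
proof -
  have "(u \<oplus> v) \<otimes> (a1 \<ominus> a2) = u \<otimes> a1 \<oplus> v \<otimes> a1 \<oplus> (y \<oplus> z)"
    using c eq by (simp add: minus_eq l_distr r_distr r_minus minus_add a_ac)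
  moreover have "x = x \<ominus> (u \<oplus> v) \<oplus> (u \<oplus> v)"
    using c by (simp add: minus_eq a_assoc l_neg)
  then have "x \<otimes> (a1 \<ominus> a2) = (x \<ominus> (u \<oplus> v)) \<otimes> (a1 \<ominus> a2) \<oplus> (u \<oplus> v) \<otimes> (a1 \<ominus> a2)"
    using c l_distr[of "x \<ominus> (u \<oplus> v)" "u \<oplus> v" "a1 \<ominus> a2"] by simp
  ultimately have "x \<otimes> (a1 \<ominus> a2) \<ominus> (y \<oplus> z) =
      (x \<ominus> (u \<oplus> v)) \<otimes> (a1 \<ominus> a2) \<oplus> (u \<otimes> a1 \<oplus> v \<otimes> a1)"
    using c by (simp add: minus_eq a_assoc r_neg)
  then show ?thesis
    using c mem by (simp add: a_closed I_r_closed)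
qed

text \<open>\<open>foldr\<close> peels factors off at the left, whereas the expansion appends each
  new factor at the right.\<close>

lemma (in monoid) foldr_mult_snoc:
  assumes "set xs \<subseteq> carrier G" "y \<in> carrier G"
  shows "foldr (\<otimes>) (xs @ [y]) \<one> = foldr (\<otimes>) xs \<one> \<otimes> y"
    and "foldr (\<otimes>) xs \<one> \<in> carrier G"
  using assms by (induction xs) (auto simp: m_assoc)

section \<open>Tensor powers\<close>

lemma lookup_fscale: "Poly_Mapping.lookup (fscale k f) x = k * Poly_Mapping.lookup f x"
  by (simp add: Poly_Mapping.map.rep_eq when_def)

lemma fscale_single: "fscale k (Poly_Mapping.single x l) = Poly_Mapping.single x (k * l)"
  by (rule poly_mapping_eqI) (simp add: lookup_fscale lookup_single when_def)

interpretation free: Modules.module "fscale :: 'k::field \<Rightarrow> ('b \<Rightarrow>\<^sub>0 'k) \<Rightarrow> _"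
  by unfold_locales
    (auto intro!: poly_mapping_eqI simp: lookup_fscale lookup_add algebra_simps)

interpretation relations: additive_cosets "tensor_relations A n"
  for A :: "('k::field, 'h, 'm) module_scheme" and n
  by unfold_locales (auto simp: tensor_relations_def intro: free.span_zero free.span_diff)

lemma tensor_class_eq_iff:
  "tensor_class A n f = tensor_class A n g \<longleftrightarrow> f - g \<in> tensor_relations A n"
  by (simp add: tensor_class_def relations.coset_eq_iff)

lemma tensor_relations_scale:
  "f \<in> tensor_relations A n \<Longrightarrow> fscale k f \<in> tensor_relations A n"
  by (simp add: tensor_relations_def free.span_scale)

lemma koszul_mult_single:
  "koszul_mult A G (Poly_Mapping.single xs k) (Poly_Mapping.single ys l) =
     Poly_Mapping.single (map2 (mult A) xs ys) (k * l * koszul_sign G xs ys)"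
  by (cases "k = 0"; cases "l = 0") (auto simp: koszul_mult_def fscale_single)

lemma koszul_sign_eq_1:
  assumes "\<And>i j. j < i \<Longrightarrow> i < length xs \<Longrightarrow> hdegree G (xs ! i) = 0 \<or> hdegree G (ys ! j) = 0"
  shows "koszul_sign G xs ys = 1"
proof -
  have "(\<Sum>i<length xs. \<Sum>j<i. hdegree G (xs ! i) * hdegree G (ys ! j)) = 0"
    using assms by (intro sum.neutral ballI) auto
  then show ?thesis by (simp only: koszul_sign_def power_0)
qed

lemma tensor_power_simps:
  "carrier (tensor_power A G n) = tensor_class A n ` {f. Poly_Mapping.keys f \<subseteq> tuples A n}"
  "\<zero>\<^bsub>tensor_power A G n\<^esub> = tensor_class A n 0"
  "tensor_class A n f \<oplus>\<^bsub>tensor_power A G n\<^esub> tensor_class A n g = tensor_class A n (f + g)"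
  by (simp_all add: tensor_power_def tensor_class_def relations.coset_add)

lemma tensor_class_closed:
  "Poly_Mapping.keys f \<subseteq> tuples A n \<Longrightarrow> tensor_class A n f \<in> carrier (tensor_power A G n)"
  by (auto simp: tensor_power_def)

lemma tensor_power_smult:
  "k \<odot>\<^bsub>tensor_power A G n\<^esub> tensor_class A n f = tensor_class A n (fscale k f)"
proof -
  have "(\<Union>x\<in>f +o tensor_relations A n. fscale k x +o tensor_relations A n)
      = fscale k f +o tensor_relations A n"
    by (rule relations.Union_image_coset)
      (metis free.scale_right_diff_distrib tensor_relations_scale)
  then show ?thesis by (simp add: tensor_power_def tensor_class_def)
qed

section \<open>Supports, products and closure in a tensor power\<close>

text \<open>These axioms do not mention products in \<open>A\<close>, so they can be verified before
  closure of products is known. The product axioms are added in \<open>graded_algebra\<close>, once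
  closure has been extracted from the tensor power.\<close>

locale graded_unital =
  fixes A :: "('k::field, 'h, 'm) module_scheme" and G :: "nat \<Rightarrow> 'h set"
  assumes add_closed: "x \<in> carrier A \<Longrightarrow> y \<in> carrier A \<Longrightarrow> x \<oplus>\<^bsub>A\<^esub> y \<in> carrier A"
    and smult_closed: "x \<in> carrier A \<Longrightarrow> k \<odot>\<^bsub>A\<^esub> x \<in> carrier A"
    and zero_smult: "x \<in> carrier A \<Longrightarrow> 0 \<odot>\<^bsub>A\<^esub> x = \<zero>\<^bsub>A\<^esub>"
    and degree_subset: "G p \<subseteq> carrier A"
    and degree_unique: "x \<in> G p \<Longrightarrow> x \<in> G q \<Longrightarrow> p \<noteq> q \<Longrightarrow> x = \<zero>\<^bsub>A\<^esub>"
    and one_degree: "\<one>\<^bsub>A\<^esub> \<in> G 0"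
begin

lemma homogeneous_tuples_subset: "homogeneous_tuples G n \<subseteq> tuples A n"
  using degree_subset by (fastforce simp: homogeneous_tuples_def tuples_def)

lemma hdegree_one: "hdegree G \<one>\<^bsub>A\<^esub> = 0"
  unfolding hdegree_def using one_degree by (rule Least_eq_0)

lemma hdegree_eq:
  assumes "x \<in> G p" "x \<noteq> \<zero>\<^bsub>A\<^esub>"
  shows "hdegree G x = p"
  unfolding hdegree_def using assms degree_unique
  by (metis (mono_tags, lifting) LeastI)

text \<open>The generators are supported on tuples over the carrier, and such elements form a
  subspace. Hence being supported on these tuples is a property of the class, shared by all its
  representatives.\<close>

lemma tensor_relations_keys:
  assumes "f \<in> tensor_relations A n"
  shows "Poly_Mapping.keys f \<subseteq> tuples A n"
proof -
  let ?S = "{f :: 'h list \<Rightarrow>\<^sub>0 'k. Poly_Mapping.keys f \<subseteq> tuples A n}"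
  have update: "xs[i := x] \<in> tuples A n" if "xs \<in> tuples A n" "x \<in> carrier A" for xs i x
    using that set_update_subset_insert[of xs i x] by (auto simp: tuples_def)
  have keys_fscale: "Poly_Mapping.keys (fscale k g) \<subseteq> Poly_Mapping.keys g"
    for k :: 'k and g :: "'h list \<Rightarrow>\<^sub>0 'k"
    by (auto simp: in_keys_iff lookup_fscale)
  have diff: "g - h \<in> ?S" if "g \<in> ?S" "h \<in> ?S" for g h
    using keys_diff[of g h] that by auto
  have single: "fbasis xs \<in> ?S" if "xs \<in> tuples A n" for xs
    using that by simp
  have scale: "fscale k g \<in> ?S" if "g \<in> ?S" for k g
    using keys_fscale[of k g] that by auto
  have sub: "free.subspace ?S"
  proof (rule free.subspaceI)
    show "g + h \<in> ?S" if "g \<in> ?S" "h \<in> ?S" for g h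
      using keys_add[of g h] that by auto
  qed (use scale in auto)
  have "tensor_relations A n \<subseteq> ?S"
    unfolding tensor_relations_def
  proof (rule free.span_minimal[OF _ sub], rule Un_least; rule subsetI)
    fix v :: "'h list \<Rightarrow>\<^sub>0 'k"
    assume "v \<in> {fbasis (xs[i := x \<oplus>\<^bsub>A\<^esub> y]) - fbasis (xs[i := x]) - fbasis (xs[i := y]) |xs i x y.
         xs \<in> tuples A n \<and> i < n \<and> x \<in> carrier A \<and> y \<in> carrier A}"
    then obtain xs i x y where v: "v = fbasis (xs[i := x \<oplus>\<^bsub>A\<^esub> y]) - fbasis (xs[i := x]) - fbasis (xs[i := y])"
      "xs \<in> tuples A n" "x \<in> carrier A" "y \<in> carrier A" by blast
    show "v \<in> ?S"
      unfolding v(1) using v(2-) by (intro diff single update add_closed)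
  next
    fix v :: "'h list \<Rightarrow>\<^sub>0 'k"
    assume "v \<in> {fbasis (xs[i := k \<odot>\<^bsub>A\<^esub> x]) - fscale k (fbasis (xs[i := x])) |xs i k x.
         xs \<in> tuples A n \<and> i < n \<and> x \<in> carrier A}"
    then obtain xs i k x where v: "v = fbasis (xs[i := k \<odot>\<^bsub>A\<^esub> x]) - fscale k (fbasis (xs[i := x]))"
      "xs \<in> tuples A n" "x \<in> carrier A" by blast
    show "v \<in> ?S"
      unfolding v(1) using v(2-) by (intro diff scale single update smult_closed)
  qed
  then show ?thesis using assms by auto
qed

lemma tensor_class_eq_keys:
  assumes "tensor_class A n f = tensor_class A n g" "Poly_Mapping.keys g \<subseteq> tuples A n"
  shows "Poly_Mapping.keys f \<subseteq> tuples A n"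
proof -
  have "Poly_Mapping.keys (f - g) \<subseteq> tuples A n"
    using assms(1) tensor_relations_keys by (simp add: tensor_class_eq_iff)
  moreover have "f = (f - g) + g" by simp
  ultimately show ?thesis
    using assms(2) keys_add[of "f - g" g] by fastforce
qed

lemma tensor_class_single_zero:
  assumes "xs \<in> tuples A n" "\<zero>\<^bsub>A\<^esub> \<in> set xs"
  shows "Poly_Mapping.single xs k \<in> tensor_relations A n"
proof -
  obtain i where i: "i < n" "xs ! i = \<zero>\<^bsub>A\<^esub>"
    using assms by (auto simp: in_set_conv_nth tuples_def)
  have c: "\<one>\<^bsub>A\<^esub> \<in> carrier A" using one_degree degree_subset by blast
  \<comment> \<open>Writing the zero entry as \<open>0\<close> times the unit makes the scaling
    relation with scalar \<open>0\<close> collapse to the tuple itself.\<close>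
  have "xs[i := 0 \<odot>\<^bsub>A\<^esub> \<one>\<^bsub>A\<^esub>] = xs"
    using i by (metis c list_update_id zero_smult)
  moreover have "fbasis (xs[i := 0 \<odot>\<^bsub>A\<^esub> \<one>\<^bsub>A\<^esub>]) - fscale 0 (fbasis (xs[i := \<one>\<^bsub>A\<^esub>])) \<in> tensor_relations A n"
    unfolding tensor_relations_def using assms(1) i(1) c by (intro free.span_base) blast
  ultimately have "fbasis xs \<in> tensor_relations A n"
    by simp
  from tensor_relations_scale[OF this, of k] show ?thesis
    by (simp add: fscale_single)
qed

text \<open>Closure of the ring multiplication makes the defining union a single coset, so the given
  pair \<open>f\<close>, \<open>g\<close> already determines the product.\<close>

lemma tensor_power_mult:
  assumes "ring (tensor_power A G n)"
    and f: "Poly_Mapping.keys f \<subseteq> homogeneous_tuples G n"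
    and g: "Poly_Mapping.keys g \<subseteq> homogeneous_tuples G n"
  shows "tensor_class A n f \<otimes>\<^bsub>tensor_power A G n\<^esub> tensor_class A n g =
    tensor_class A n (koszul_mult A G f g)"
proof -
  interpret T: ring "tensor_power A G n" by fact
  let ?T = "tensor_power A G n"
  let ?J = "{f' \<in> tensor_class A n f. Poly_Mapping.keys f' \<subseteq> homogeneous_tuples G n} \<times>
    {g' \<in> tensor_class A n g. Poly_Mapping.keys g' \<subseteq> homogeneous_tuples G n}"
  have "tensor_class A n f \<in> carrier ?T" "tensor_class A n g \<in> carrier ?T"
    using f g homogeneous_tuples_subset[of n] by (auto intro!: tensor_class_closed)
  from T.m_closed[OF this] obtain h where
    h: "tensor_class A n f \<otimes>\<^bsub>?T\<^esub> tensor_class A n g = h +o tensor_relations A n"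
    by (auto simp: tensor_power_simps tensor_class_def)
  have U: "tensor_class A n f \<otimes>\<^bsub>?T\<^esub> tensor_class A n g =
      (\<Union>x\<in>?J. koszul_mult A G (fst x) (snd x) +o tensor_relations A n)"
    by (simp add: tensor_power_def tensor_class_def UN_UN_Times)
  have "(f, g) \<in> ?J"
    using f g by (simp add: tensor_class_def relations.self_mem_coset)
  from relations.Union_cosets_eq[OF U[symmetric, unfolded h] this] show ?thesis
    unfolding U by (simp add: tensor_class_def)
qed

text \<open>Multiply x \<otimes> ... \<otimes> x by y \<otimes> ... \<otimes> y. The result is
  represented by one tuple with all entries xy, and since its class lies in the carrier, so does
  xy.\<close>

lemma mult_closed_of_ring_tensor_power:
  assumes "ring (tensor_power A G n)" "n > 0" and x: "x \<in> G p" and y: "y \<in> G q"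
  shows "x \<otimes>\<^bsub>A\<^esub> y \<in> carrier A"
proof -
  interpret T: ring "tensor_power A G n" by fact
  let ?T = "tensor_power A G n"
  let ?xs = "replicate n x" and ?ys = "replicate n y"
  have h: "?xs \<in> homogeneous_tuples G n" "?ys \<in> homogeneous_tuples G n"
    using x y by (auto simp: homogeneous_tuples_def)
  then have "tensor_class A n (fbasis ?xs) \<in> carrier ?T" "tensor_class A n (fbasis ?ys) \<in> carrier ?T"
    using homogeneous_tuples_subset[of n] by (auto intro!: tensor_class_closed)
  from T.m_closed[OF this] obtain g where g: "Poly_Mapping.keys g \<subseteq> tuples A n"
    and "tensor_class A n (koszul_mult A G (fbasis ?xs) (fbasis ?ys)) = tensor_class A n g"
    using h by (auto simp: tensor_power_mult[OF assms(1)] tensor_power_simps)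
  \<comment> \<open>The coefficient of the tuple is a power of -1 and hence nonzero, so the tuple
    really is a key.\<close>
  from tensor_class_eq_keys[OF this(2) g] have "map2 (mult A) ?xs ?ys \<in> tuples A n"
    by (simp add: koszul_mult_single koszul_sign_def)
  then show ?thesis using \<open>n > 0\<close> by (simp add: tuples_def zip_replicate)
qed

end

section \<open>Homogeneous monomials in the tensor power\<close>

locale graded_algebra = graded_unital A G
  for A :: "('k::field, 'h, 'm) module_scheme" and G :: "nat \<Rightarrow> 'h set" +
  assumes mult_degree: "x \<in> G p \<Longrightarrow> y \<in> G q \<Longrightarrow> x \<otimes>\<^bsub>A\<^esub> y \<in> G (p + q)"
    and left_unit: "x \<in> G p \<Longrightarrow> \<one>\<^bsub>A\<^esub> \<otimes>\<^bsub>A\<^esub> x = x"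
    and right_unit: "x \<in> G p \<Longrightarrow> x \<otimes>\<^bsub>A\<^esub> \<one>\<^bsub>A\<^esub> = x"

locale graded_tensor_ring = graded_algebra A G + ring "tensor_power A G n"
  for A :: "('k::field, 'h, 'm) module_scheme" and G :: "nat \<Rightarrow> 'h set" and n :: nat
begin

abbreviation T :: "('k, ('h list \<Rightarrow>\<^sub>0 'k) set) module" where
  "T \<equiv> tensor_power A G n"

definition homogeneous :: "(nat \<Rightarrow> 'h) \<Rightarrow> bool" where
  "homogeneous f \<longleftrightarrow> (\<forall>j. \<exists>p. f j \<in> G p)"

text \<open>Entries are a function of the position, counted from 1, so products of tuples become
  pointwise. Carrying the coefficient along absorbs negation, scalars and Koszul signs.\<close>

definition monomial :: "'k \<Rightarrow> (nat \<Rightarrow> 'h) \<Rightarrow> ('h list \<Rightarrow>\<^sub>0 'k) set" where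
  "monomial k f = tensor_class A n (Poly_Mapping.single (map f [1..<n + 1]) k)"

lemma homogeneous_tuple:
  "homogeneous f \<Longrightarrow> map f [1..<n + 1] \<in> homogeneous_tuples G n"
  by (auto simp: homogeneous_def homogeneous_tuples_def)

lemma homogeneous_tuple': "homogeneous f \<Longrightarrow> map f [1..<n + 1] \<in> tuples A n"
  using homogeneous_tuple homogeneous_tuples_subset by blast

lemma monomial_closed: "homogeneous f \<Longrightarrow> monomial k f \<in> carrier T"
  unfolding monomial_def using homogeneous_tuple'[of f] by (intro tensor_class_closed) simp

lemma minus_monomial:
  assumes "homogeneous f"
  shows "\<ominus>\<^bsub>T\<^esub> monomial k f = monomial (- k) f"
proof (rule minus_equality)
  show "monomial (- k) f \<oplus>\<^bsub>T\<^esub> monomial k f = \<zero>\<^bsub>T\<^esub>"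
    by (simp add: monomial_def tensor_power_simps flip: single_add)
qed (use assms monomial_closed in auto)

lemma smult_monomial: "c \<odot>\<^bsub>T\<^esub> monomial k f = monomial (c * k) f"
  by (simp add: monomial_def tensor_power_smult fscale_single)

lemma smult_monomial_add: "c \<odot>\<^bsub>T\<^esub> (monomial k f \<oplus>\<^bsub>T\<^esub> monomial l g) = monomial (c * k) f \<oplus>\<^bsub>T\<^esub> monomial (c * l) g"
  by (simp add: monomial_def tensor_power_smult fscale_single tensor_power_simps free.scale_right_distrib)

text \<open>Both classes are zero. This allows any exchange of signs when \<open>a\<close> or
  \<open>b\<close> vanishes and its degree is ambiguous.\<close>

lemma monomial_zero_entry:
  assumes "homogeneous f" "1 \<le> i" "i \<le> n" "f i = \<zero>\<^bsub>A\<^esub>"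
  shows "monomial k f = monomial l f"
proof -
  have "f i \<in> set (map f [1..<n + 1])" using assms(2,3) by (auto simp del: upt_Suc)
  from tensor_class_single_zero[OF homogeneous_tuple'[OF assms(1)] this[unfolded assms(4)], of "k - l"]
  show ?thesis by (simp add: monomial_def tensor_class_eq_iff single_diff)
qed

lemma monomial_mult:
  assumes "homogeneous f" "homogeneous g"
  shows "monomial k f \<otimes>\<^bsub>T\<^esub> monomial l g =
    monomial (k * l * koszul_sign G (map f [1..<n + 1]) (map g [1..<n + 1])) (\<lambda>j. f j \<otimes>\<^bsub>A\<^esub> g j)"
proof -
  have "map2 (mult A) (map f [1..<n + 1]) (map g [1..<n + 1]) = map (\<lambda>j. f j \<otimes>\<^bsub>A\<^esub> g j) [1..<n + 1]"
    by (simp add: zip_map_map zip_same_conv_map)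
  then show ?thesis
    using assms[THEN homogeneous_tuple] unfolding monomial_def
    by (subst tensor_power_mult[OF ring_axioms]) (auto simp: koszul_mult_single)
qed

text \<open>Every interchange prescribed by the Koszul rule involves an entry of degree 0. The
  function \<open>h\<close> is compared with the product on positions 1 to n only, so a convenient
  name for the result can be supplied.\<close>

lemma monomial_mult_unsigned:
  assumes "homogeneous f" "homogeneous g"
    and "\<And>i j. 1 \<le> j \<Longrightarrow> j < i \<Longrightarrow> i \<le> n \<Longrightarrow> hdegree G (f i) = 0 \<or> hdegree G (g j) = 0"
    and "\<And>j. 1 \<le> j \<Longrightarrow> j \<le> n \<Longrightarrow> h j = f j \<otimes>\<^bsub>A\<^esub> g j"
  shows "monomial k f \<otimes>\<^bsub>T\<^esub> monomial l g = monomial (k * l) h"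
proof -
  have "koszul_sign G (map f [1..<n + 1]) (map g [1..<n + 1]) = (1 :: 'k)"
    by (rule koszul_sign_eq_1) (use assms(3) in \<open>simp add: nth_upt del: upt_Suc\<close>)
  moreover have "monomial c h = monomial c (\<lambda>j. f j \<otimes>\<^bsub>A\<^esub> g j)" for c
    unfolding monomial_def using assms(4) by (intro arg_cong[of _ _ "\<lambda>xs. tensor_class A n (Poly_Mapping.single xs c)"] map_cong) auto
  ultimately show ?thesis
    by (simp add: monomial_mult assms(1,2))
qed

definition pos :: "nat \<Rightarrow> 'h \<Rightarrow> nat \<Rightarrow> 'h" where
  "pos i x = (\<lambda>j. if j = i then x else \<one>\<^bsub>A\<^esub>)"

lemma pure_tensor_map: "pure_tensor A (map f [1..<n + 1]) = monomial 1 f"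
  by (simp add: pure_tensor_def monomial_def del: upt_Suc)

lemma in_position_eq_monomial: "in_position A n i x = monomial 1 (pos i x)"
  unfolding in_position_def pure_tensor_map pos_def ..

lemma homogeneous_pos: "x \<in> G p \<Longrightarrow> homogeneous (pos i x)"
  using one_degree by (auto simp: homogeneous_def pos_def)

text \<open>Factor the monomial as \<open>x\<close> in slot 1 times the monomial with slot 1 reset
  to the unit. No sign arises, because the left factor has units behind slot 1.\<close>

lemma monomial_mem_ideal:
  assumes J: "ideal J T" and x: "x \<in> G p" and mem: "in_position A n 1 x \<in> J"
    and f: "homogeneous f" "f 1 = x"
  shows "monomial k f \<in> J"
proof -
  have h: "homogeneous (f(1 := \<one>\<^bsub>A\<^esub>))"
    using f one_degree by (auto simp: homogeneous_def)
  have "\<one>\<^bsub>A\<^esub> \<otimes>\<^bsub>A\<^esub> f j = f j" for j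
    using f left_unit by (auto simp: homogeneous_def)
  then have "monomial 1 (pos 1 x) \<otimes>\<^bsub>T\<^esub> monomial k (f(1 := \<one>\<^bsub>A\<^esub>)) = monomial (1 * k) f"
    using x f(2) by (intro monomial_mult_unsigned homogeneous_pos[OF x] h)
      (auto simp: pos_def hdegree_one left_unit right_unit)
  then show ?thesis
    using ideal.I_r_closed[OF J mem monomial_closed[OF h, of k]] by (simp add: in_position_eq_monomial)
qed

section \<open>The Koszul sign and the expansion modulo an ideal\<close>

lemma koszul_sign_pos:
  assumes "n \<ge> 2"
  shows "koszul_sign G (map (pos 2 b) [1..<n + 1]) (map (pos 1 a) [1..<n + 1]) =
    (-1 :: 'k) ^ (hdegree G a * hdegree G b)"
proof -
  \<comment> \<open>List indices start at 0: slot 2 has index 1 and slot 1 has index 0. Only this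
    pair contributes, all other entries being units.\<close>
  have "(\<Sum>j<i. hdegree G (map (pos 2 b) [1..<n + 1] ! i) * hdegree G (map (pos 1 a) [1..<n + 1] ! j))
      = (if i = 1 then hdegree G a * hdegree G b else 0)" if "i < n" for i
    using that by (simp add: pos_def hdegree_one nth_upt del: upt_Suc)
  then have "(\<Sum>i<n. \<Sum>j<i. hdegree G (map (pos 2 b) [1..<n + 1] ! i) * hdegree G (map (pos 1 a) [1..<n + 1] ! j))
      = (\<Sum>i<n. if i = 1 then hdegree G a * hdegree G b else 0)"
    by (intro sum.cong) auto
  also have "\<dots> = hdegree G a * hdegree G b"
    using assms by simp
  finally show ?thesis by (simp add: koszul_sign_def del: upt_Suc)
qed

text \<open>The expansion inside one ideal \<open>J\<close> containing the generators, by induction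
  on the index \<open>m\<close> of the last factor a_1 - a_m.\<close>

theorem mult_differences_in_ideal:
  assumes a: "a \<in> G p" and b: "b \<in> G q" and n: "n \<ge> 2"
    and J: "ideal J T"
    and aa: "in_position A n 1 (a \<otimes>\<^bsub>A\<^esub> a) \<in> J"
    and ba: "in_position A n 1 (b \<otimes>\<^bsub>A\<^esub> a) \<in> J"
    and ba': "in_position A n 2 (b \<otimes>\<^bsub>A\<^esub> a) \<in> J"
  shows "((in_position A n 1 b \<ominus>\<^bsub>T\<^esub> in_position A n 2 b) \<otimes>\<^bsub>T\<^esub>
        foldr (mult T) (map (\<lambda>i. in_position A n 1 a \<ominus>\<^bsub>T\<^esub> in_position A n i a) [2..<n + 1]) \<one>\<^bsub>T\<^esub>)
      \<ominus>\<^bsub>T\<^esub> ((-1) ^ (n + 1)) \<odot>\<^bsub>T\<^esub>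
        (pure_tensor A (b # a # replicate (n - 2) a) \<oplus>\<^bsub>T\<^esub>
          ((-1) ^ (p * q)) \<odot>\<^bsub>T\<^esub> pure_tensor A (a # b # replicate (n - 2) a)) \<in> J"
proof -
  interpret J: ideal J T by fact
  \<comment> \<open>\<open>U m\<close> and \<open>V m\<close> describe b \<otimes> a \<otimes> a ...
    and a \<otimes> b \<otimes> a ... filled up to slot \<open>m\<close>, with units behind it. The
    sign \<open>s m\<close> starts at \<open>s 2 = -1\<close>, and \<open>P m\<close> has the
    \<open>m - 1\<close> factors \<open>D 2\<close> to \<open>D m\<close>.\<close>
  define U where "U m j = (if j = 1 then b else if 2 \<le> j \<and> j \<le> m then a else \<one>\<^bsub>A\<^esub>)" for m j :: nat
  define V where "V m j = (if j = 1 then a else if j = 2 then b else if 2 < j \<and> j \<le> m then a else \<one>\<^bsub>A\<^esub>)" for m j :: nat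
  define s :: "nat \<Rightarrow> 'k" where "s m = (-1) ^ (m + 1)" for m
  define e :: 'k where "e = (-1) ^ (p * q)"
  define D where "D i = monomial 1 (pos 1 a) \<ominus>\<^bsub>T\<^esub> monomial 1 (pos i a)" for i
  define L where "L = monomial 1 (pos 1 b) \<ominus>\<^bsub>T\<^esub> monomial 1 (pos 2 b)"
  define P where "P m = foldr (mult T) (map D [2..<m + 1]) \<one>\<^bsub>T\<^esub>" for m
  have hU: "homogeneous (U m)" and hV: "homogeneous (V m)" for m
    using a b one_degree by (auto simp: U_def V_def homogeneous_def)
  have ha: "homogeneous (pos i a)" and hb: "homogeneous (pos i b)" for i
    using a b homogeneous_pos by auto
  note closed = monomial_closed[OF hU] monomial_closed[OF hV] monomial_closed[OF ha] monomial_closed[OF hb]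
  have L_closed: "L \<in> carrier T" and D_closed: "D i \<in> carrier T" for i
    using closed by (auto simp: L_def D_def)
  have P_Suc: "P (Suc m) = P m \<otimes>\<^bsub>T\<^esub> D (Suc m)" and P_closed: "P m \<in> carrier T" if "m \<ge> 1" for m
  proof -
    have "[2..<Suc m + 1] = [2..<m + 1] @ [Suc m]" using that by simp
    then show "P (Suc m) = P m \<otimes>\<^bsub>T\<^esub> D (Suc m)" "P m \<in> carrier T"
      using D_closed foldr_mult_snoc[of "map D [2..<m + 1]" "D (Suc m)"]
      by (auto simp: P_def simp del: upt_Suc)
  qed
  note units = left_unit[OF a] right_unit[OF a] left_unit[OF b] right_unit[OF b]
    left_unit[OF one_degree]
  have aa_degree: "a \<otimes>\<^bsub>A\<^esub> a \<in> G (p + p)" and ba_degree: "b \<otimes>\<^bsub>A\<^esub> a \<in> G (q + p)"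
    using a b mult_degree by auto
  have h_mult: "homogeneous (\<lambda>j. f j \<otimes>\<^bsub>A\<^esub> g j)" if "homogeneous f" "homogeneous g" for f g
    using that mult_degree unfolding homogeneous_def by blast

  \<comment> \<open>Invariant: modulo \<open>J\<close>, exactly the two monomials with entries
    \<open>U m\<close> and \<open>V m\<close> remain.\<close>
  have "L \<otimes>\<^bsub>T\<^esub> P m \<ominus>\<^bsub>T\<^esub> (monomial (s m) (U m) \<oplus>\<^bsub>T\<^esub> monomial (s m * e) (V m)) \<in> J"
    if "2 \<le> m" "m \<le> n" for m
    using that
  proof (induction m rule: dec_induct)
    case base
    have "P 2 = D 2"
      using D_closed by (simp add: P_def)
    \<comment> \<open>Slot 1 holds ba. The sign can stay unevaluated, since
      \<open>monomial_mem_ideal\<close> allows any coefficient.\<close>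
    have b1a1: "monomial 1 (pos 1 b) \<otimes>\<^bsub>T\<^esub> monomial 1 (pos 1 a) \<in> J"
      unfolding monomial_mult[OF hb ha]
      by (rule monomial_mem_ideal[OF J ba_degree ba h_mult[OF hb ha]]) (simp add: pos_def)
    have b2a2: "monomial 1 (pos 2 b) \<otimes>\<^bsub>T\<^esub> monomial 1 (pos 2 a) \<in> J"
    proof -
      have "monomial 1 (pos 2 b) \<otimes>\<^bsub>T\<^esub> monomial 1 (pos 2 a) = monomial (1 * 1) (pos 2 (b \<otimes>\<^bsub>A\<^esub> a))"
        by (rule monomial_mult_unsigned[OF hb ha]) (auto simp: pos_def hdegree_one units)
      then show ?thesis using ba' by (simp add: in_position_eq_monomial)
    qed
    have b1a2: "monomial 1 (pos 1 b) \<otimes>\<^bsub>T\<^esub> monomial 1 (pos 2 a) = monomial (1 * 1) (U 2)"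
      by (rule monomial_mult_unsigned[OF hb ha]) (auto simp: pos_def U_def hdegree_one units)
    \<comment> \<open>This product is the origin of the sign in the statement: b in slot 2 passes a
      in slot 1.\<close>
    have b2a1: "monomial 1 (pos 2 b) \<otimes>\<^bsub>T\<^esub> monomial 1 (pos 1 a) = monomial e (V 2)"
    proof -
      have "(\<lambda>j. pos 2 b j \<otimes>\<^bsub>A\<^esub> pos 1 a j) = V 2"
        by (rule ext) (simp add: pos_def V_def units)
      then have "monomial 1 (pos 2 b) \<otimes>\<^bsub>T\<^esub> monomial 1 (pos 1 a) = monomial ((-1) ^ (hdegree G a * hdegree G b)) (V 2)"
        unfolding monomial_mult[OF hb ha] koszul_sign_pos[OF n] by (simp del: upt_Suc)
      also have "\<dots> = monomial e (V 2)"
      \<comment> \<open>The sign is computed from \<open>hdegree\<close>, which for a zero class may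
        differ from \<open>p\<close> or \<open>q\<close>; in that case both monomials
        vanish.\<close>
      proof (cases "a = \<zero>\<^bsub>A\<^esub> \<or> b = \<zero>\<^bsub>A\<^esub>")
        case True
        then have "V 2 1 = \<zero>\<^bsub>A\<^esub> \<or> V 2 2 = \<zero>\<^bsub>A\<^esub>" by (auto simp: V_def)
        then show ?thesis using monomial_zero_entry[OF hV] n by (metis le_refl one_le_numeral order_trans)
      next
        case False
        then show ?thesis using a b by (simp add: hdegree_eq e_def)
      qed
      finally show ?thesis .
    qed
    have "monomial 1 (pos 1 b) \<otimes>\<^bsub>T\<^esub> monomial 1 (pos 2 a) = \<ominus>\<^bsub>T\<^esub> monomial (s 2) (U 2)"
      and "monomial 1 (pos 2 b) \<otimes>\<^bsub>T\<^esub> monomial 1 (pos 1 a) = \<ominus>\<^bsub>T\<^esub> monomial (s 2 * e) (V 2)"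
      unfolding b1a2 b2a1 by (simp_all add: minus_monomial hU hV s_def)
    then show ?case
      unfolding \<open>P 2 = D 2\<close> L_def D_def
      using closed b1a1 b2a2 by (intro J.mult_differences_cong)
  next
    case (step m)
    have IH: "L \<otimes>\<^bsub>T\<^esub> P m \<ominus>\<^bsub>T\<^esub> (monomial (s m) (U m) \<oplus>\<^bsub>T\<^esub> monomial (s m * e) (V m)) \<in> J"
      using step by simp
    \<comment> \<open>Multiplying by a_1 puts ba into slot 1 of the first monomial and, in
      \<open>Va\<close>, aa into slot 1 of the second. Both lie in \<open>J\<close> whatever the
      sign.\<close>
    have Ua: "monomial (s m) (U m) \<otimes>\<^bsub>T\<^esub> monomial 1 (pos 1 a) \<in> J"
      unfolding monomial_mult[OF hU ha]
      by (rule monomial_mem_ideal[OF J ba_degree ba h_mult[OF hU ha]]) (simp add: pos_def U_def)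
    have Va: "monomial (s m * e) (V m) \<otimes>\<^bsub>T\<^esub> monomial 1 (pos 1 a) \<in> J"
      unfolding monomial_mult[OF hV ha]
      by (rule monomial_mem_ideal[OF J aa_degree aa h_mult[OF hV ha]]) (simp add: pos_def V_def)
    \<comment> \<open>Slot \<open>Suc m\<close> still holds a unit, so a fills it. Behind it there
      are only units, so no sign occurs here or in \<open>Vd\<close>.\<close>
    have Ud: "monomial (s m) (U m) \<otimes>\<^bsub>T\<^esub> monomial 1 (pos (Suc m) a) = monomial (s m * 1) (U (Suc m))"
      using step.hyps
      by (intro monomial_mult_unsigned[OF hU ha]) (auto simp: pos_def U_def hdegree_one units)
    have Vd: "monomial (s m * e) (V m) \<otimes>\<^bsub>T\<^esub> monomial 1 (pos (Suc m) a) = monomial (s m * e * 1) (V (Suc m))"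
      using step.hyps
      by (intro monomial_mult_unsigned[OF hV ha]) (auto simp: pos_def V_def hdegree_one units)
    have "monomial (s m) (U m) \<otimes>\<^bsub>T\<^esub> monomial 1 (pos (Suc m) a) = \<ominus>\<^bsub>T\<^esub> monomial (s (Suc m)) (U (Suc m))"
      and "monomial (s m * e) (V m) \<otimes>\<^bsub>T\<^esub> monomial 1 (pos (Suc m) a) = \<ominus>\<^bsub>T\<^esub> monomial (s (Suc m) * e) (V (Suc m))"
      unfolding Ud Vd by (simp_all add: minus_monomial hU hV s_def)
    then have "(L \<otimes>\<^bsub>T\<^esub> P m) \<otimes>\<^bsub>T\<^esub> D (Suc m)
        \<ominus>\<^bsub>T\<^esub> (monomial (s (Suc m)) (U (Suc m)) \<oplus>\<^bsub>T\<^esub> monomial (s (Suc m) * e) (V (Suc m))) \<in> J"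
      unfolding D_def
      using closed L_closed P_closed[of m] step.hyps IH Ua Va
      by (intro J.mult_difference_step[where u = "monomial (s m) (U m)" and v = "monomial (s m * e) (V m)"] m_closed)
        auto
    moreover have "L \<otimes>\<^bsub>T\<^esub> P (Suc m) = (L \<otimes>\<^bsub>T\<^esub> P m) \<otimes>\<^bsub>T\<^esub> D (Suc m)"
      using step.hyps P_Suc P_closed[of m] L_closed D_closed by (simp add: m_assoc)
    ultimately show ?case by simp
  qed
  from this[OF n order_refl]
  have "L \<otimes>\<^bsub>T\<^esub> P n \<ominus>\<^bsub>T\<^esub> (monomial (s n) (U n) \<oplus>\<^bsub>T\<^esub> monomial (s n * e) (V n)) \<in> J" .
  \<comment> \<open>For \<open>m = n\<close> no slot with a unit is left, and the entries are those
    of the two tensors in the statement.\<close>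
  moreover have U: "map (U n) [1..<n + 1] = b # a # replicate (n - 2) a"
    and V: "map (V n) [1..<n + 1] = a # b # replicate (n - 2) a"
    using n by (auto intro!: nth_equalityI simp: nth_Cons' U_def V_def nth_upt simp del: upt_Suc)
  have "pure_tensor A (b # a # replicate (n - 2) a) = monomial 1 (U n)"
    and "pure_tensor A (a # b # replicate (n - 2) a) = monomial 1 (V n)"
    by (simp_all only: pure_tensor_map flip: U V)
  ultimately show ?thesis
    by (simp add: in_position_eq_monomial smult_monomial smult_monomial_add P_def D_def[abs_def] L_def s_def e_def
        del: upt_Suc)
qed

end

section \<open>The cohomology algebra\<close>

definition degree_part :: "nat \<Rightarrow> ('a, 'k::field) cochain \<Rightarrow> ('a, 'k) cochain" where
  "degree_part p c = (\<lambda>q. if q = p then c q else (\<lambda>\<sigma>. 0))"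

lemma degree_part_diff: "degree_part p (c - d) = degree_part p c - degree_part p d"
  by (auto simp: degree_part_def fun_eq_iff)

lemma degree_part_eq: "(\<And>q. q \<noteq> p \<Longrightarrow> z q = (\<lambda>\<sigma>. 0)) \<Longrightarrow> degree_part p z = z"
  and degree_part_eq_0: "(\<And>q. q \<noteq> p \<Longrightarrow> z q = (\<lambda>\<sigma>. 0)) \<Longrightarrow> p' \<noteq> p \<Longrightarrow> degree_part p' z = 0"
  by (auto simp: degree_part_def fun_eq_iff)

lemma coboundary_diff: "coboundary X (c - d) = coboundary X c - coboundary X d"
  by (auto simp: coboundary_def fun_eq_iff right_diff_distrib sum_subtractf)

lemma coboundary_add: "coboundary X (c + d) = coboundary X c + coboundary X d"
  by (auto simp: coboundary_def fun_eq_iff distrib_left sum.distrib)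

lemma coboundary_scale: "coboundary X (\<lambda>p \<sigma>. k * c p \<sigma>) = (\<lambda>p \<sigma>. k * coboundary X c p \<sigma>)"
  by (auto simp: coboundary_def fun_eq_iff sum_distrib_left mult.left_commute)

text \<open>The coboundary raises degrees by one. Hence components of coboundaries are coboundaries
  and components of cocycles are cocycles.\<close>

lemma coboundary_degree_part_Suc:
  "coboundary X (degree_part p c) = degree_part (Suc p) (coboundary X c)"
  by (auto simp: coboundary_def degree_part_def fun_eq_iff gr0_conv_Suc intro!: sum.neutral)

lemma degree_part_0_coboundary: "degree_part 0 (coboundary X c) = 0"
  by (auto simp: coboundary_def degree_part_def fun_eq_iff)

text \<open>One criterion for sums, differences, multiples and components: the support of
  \<open>e\<close> is contained in the joint support of \<open>c\<close> and
  \<open>d\<close>.\<close>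

lemma cochains_subset:
  assumes "\<And>p. c p = (\<lambda>\<sigma>. 0) \<Longrightarrow> d p = (\<lambda>\<sigma>. 0) \<Longrightarrow> e p = (\<lambda>\<sigma>. 0)"
    and "\<And>p \<sigma>. c p \<sigma> = 0 \<Longrightarrow> d p \<sigma> = 0 \<Longrightarrow> e p \<sigma> = 0"
    and "c \<in> cochains X" "d \<in> cochains X"
  shows "e \<in> cochains X"
proof -
  have "{p. e p \<noteq> (\<lambda>\<sigma>. 0)} \<subseteq> {p. c p \<noteq> (\<lambda>\<sigma>. 0)} \<union> {p. d p \<noteq> (\<lambda>\<sigma>. 0)}"
    using assms(1) by blast
  then have "finite {p. e p \<noteq> (\<lambda>\<sigma>. 0)}"
    by (rule finite_subset) (use assms(3,4) in \<open>simp add: cochains_def\<close>)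
  then show ?thesis
    using assms(2-4) by (auto simp: cochains_def)
qed

lemma cochains_add: "c \<in> cochains X \<Longrightarrow> d \<in> cochains X \<Longrightarrow> c + d \<in> cochains X"
  and cochains_diff: "c \<in> cochains X \<Longrightarrow> d \<in> cochains X \<Longrightarrow> c - d \<in> cochains X"
  and cochains_scale: "c \<in> cochains X \<Longrightarrow> (\<lambda>p \<sigma>. k * c p \<sigma>) \<in> cochains X"
  and cochains_degree_part: "c \<in> cochains X \<Longrightarrow> degree_part p c \<in> cochains X"
  by (rule cochains_subset[of c d _ X] cochains_subset[of c c _ X];
      auto simp: fun_eq_iff degree_part_def)+

lemma cochains_0: "0 \<in> cochains X"
  by (simp add: cochains_def zero_fun_def)

interpretation coboundaries: additive_cosets "coboundaries X"
  for X :: "'a topology"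
proof
  have "coboundary X 0 = 0" by (auto simp: coboundary_def fun_eq_iff)
  then show "0 \<in> coboundaries X"
    unfolding coboundaries_def using cochains_0 by (metis image_eqI)
  show "x - y \<in> coboundaries X" if "x \<in> coboundaries X" "y \<in> coboundaries X" for x y
    using that unfolding coboundaries_def by (auto simp: cochains_diff simp flip: coboundary_diff)
qed

lemma coboundaries_scale: "c \<in> coboundaries X \<Longrightarrow> (\<lambda>p \<sigma>. k * c p \<sigma>) \<in> coboundaries X"
  unfolding coboundaries_def using cochains_scale by (auto intro!: imageI simp flip: coboundary_scale)

lemma coboundaries_degree_part:
  assumes "c \<in> coboundaries X"
  shows "degree_part p c \<in> coboundaries X"
proof (cases p)
  case 0
  then show ?thesis
    using assms coboundaries.zero_mem by (auto simp: coboundaries_def degree_part_0_coboundary)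
next
  case (Suc r)
  then show ?thesis
    using assms cochains_degree_part
    by (auto simp: coboundaries_def intro!: imageI simp flip: coboundary_degree_part_Suc)
qed

lemma cocycles_cochains: "c \<in> cocycles X \<Longrightarrow> c \<in> cochains X"
  by (simp add: cocycles_def)

lemma cocycles_add: "c \<in> cocycles X \<Longrightarrow> d \<in> cocycles X \<Longrightarrow> c + d \<in> cocycles X"
  and cocycles_scale: "c \<in> cocycles X \<Longrightarrow> (\<lambda>p \<sigma>. k * c p \<sigma>) \<in> cocycles X"
  by (auto simp: cocycles_def cochains_add cochains_scale coboundary_add coboundary_scale fun_eq_iff)

lemma cocycles_degree_part: "c \<in> cocycles X \<Longrightarrow> degree_part p c \<in> cocycles X"
  by (simp add: cocycles_def cochains_degree_part coboundary_degree_part_Suc)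
    (simp add: degree_part_def)

section \<open>Cohomology classes as cosets of coboundaries\<close>

lemma cocycle_coset: "coboundaries X +>\<^bsub>cocycle_algebra X\<^esub> z = z +o coboundaries X"
proof -
  have "(\<lambda>p \<sigma>. h p \<sigma> + z p \<sigma>) = z + h" for h
    by (auto simp: fun_eq_iff)
  then show ?thesis
    by (auto simp: a_r_coset_def r_coset_def elt_set_plus_def cocycle_algebra_def)
qed

abbreviation unit_cochain :: "'a topology \<Rightarrow> ('a, 'k::field) cochain" where
  "unit_cochain X \<equiv> \<one>\<^bsub>cocycle_algebra X\<^esub>"

text \<open>The product is left as a union of cosets; it is reduced to one representative in
  \<open>cohomology_mult_coset\<close>, given closure.\<close>

lemma cohomology_algebra_simps:
  fixes X :: "'a topology" and z w :: "('a, 'k::field) cochain" and k :: 'k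
  shows "carrier (cohomology_algebra X :: ('k, ('a, 'k) cochain set) module) = (\<lambda>z. z +o coboundaries X) ` cocycles X"
  "\<zero>\<^bsub>cohomology_algebra X\<^esub> = (coboundaries X :: ('a, 'k) cochain set)"
  "\<one>\<^bsub>cohomology_algebra X\<^esub> = (unit_cochain X +o coboundaries X :: ('a, 'k) cochain set)"
  "(z +o coboundaries X) \<oplus>\<^bsub>cohomology_algebra X\<^esub> (w +o coboundaries X) = (z + w) +o coboundaries X"
  "\<And>x y :: ('a, 'k) cochain set.
     x \<otimes>\<^bsub>cohomology_algebra X\<^esub> y = (\<Union>z\<in>x \<times> y. cup X (fst z) (snd z) +o coboundaries X)"
  "k \<odot>\<^bsub>cohomology_algebra X\<^esub> (z +o coboundaries X) = (\<lambda>p \<sigma>. k * z p \<sigma>) +o coboundaries X"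
proof -
  have plus: "(\<lambda>p \<sigma>. c p \<sigma> + d p \<sigma>) = c + d" for c d :: "('a, 'k) cochain"
    by (auto simp: fun_eq_iff)
  show "carrier (cohomology_algebra X :: ('k, ('a, 'k) cochain set) module) = (\<lambda>z. z +o coboundaries X) ` cocycles X"
    by (auto simp: cohomology_algebra_def ring.defs FactRing_simps cocycle_coset)
      (auto simp: cocycle_algebra_def)
  show "\<zero>\<^bsub>cohomology_algebra X\<^esub> = (coboundaries X :: ('a, 'k) cochain set)"
    by (simp add: cohomology_algebra_def ring.defs FactRing_simps)
  show "\<one>\<^bsub>cohomology_algebra X\<^esub> = (unit_cochain X +o coboundaries X :: ('a, 'k) cochain set)"
    by (simp add: cohomology_algebra_def ring.defs FactRing_simps cocycle_coset)
  show "(z +o coboundaries X) \<oplus>\<^bsub>cohomology_algebra X\<^esub> (w +o coboundaries X) = (z + w) +o coboundaries X"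
    by (simp add: cohomology_algebra_def ring.defs FactRing_simps set_add_def set_mult_def
        cocycle_algebra_def plus flip: coboundaries.coset_add) (auto simp: set_plus_def)
  show "x \<otimes>\<^bsub>cohomology_algebra X\<^esub> y = (\<Union>z\<in>x \<times> y. cup X (fst z) (snd z) +o coboundaries X)"
    for x y :: "('a, 'k) cochain set"
    by (simp add: cohomology_algebra_def ring.defs FactRing_def rcoset_mult_def cocycle_coset
        UN_UN_Times) (simp add: cocycle_algebra_def)
  have "(\<Union>x\<in>z +o coboundaries X. (\<lambda>p \<sigma>. k * x p \<sigma>) +o coboundaries X)
      = (\<lambda>p \<sigma>. k * z p \<sigma>) +o coboundaries X"
  proof (rule coboundaries.Union_image_coset)
    fix c d :: "('a, 'k) cochain"
    assume "c - d \<in> coboundaries X"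
    from coboundaries_scale[OF this, of k]
    show "(\<lambda>p \<sigma>. k * c p \<sigma>) - (\<lambda>p \<sigma>. k * d p \<sigma>) \<in> coboundaries X"
      by (simp add: right_diff_distrib fun_diff_def)
  qed
  then show "k \<odot>\<^bsub>cohomology_algebra X\<^esub> (z +o coboundaries X) = (\<lambda>p \<sigma>. k * z p \<sigma>) +o coboundaries X"
    by (simp add: cohomology_algebra_def ring.defs Module.module.defs cocycle_coset)
      (simp add: cocycle_algebra_def)
qed

lemma cohomology_eq:
  "cohomology X p = {z +o coboundaries X |z. z \<in> cocycles X \<and> (\<forall>q. q \<noteq> p \<longrightarrow> z q = (\<lambda>\<sigma>. 0))}"
  by (simp add: cohomology_def cocycle_coset)

section \<open>The unit class and the degrees of cup products\<close>

lemma unit_cochain_cocycle: "unit_cochain X \<in> cocycles X"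
proof -
  have "coboundary X (unit_cochain X) p \<sigma> = 0" for p \<sigma>
  proof (cases "p = 1")
    case True
    \<comment> \<open>Both endpoints of a singular 1-simplex are singular 0-simplices, so the
      coboundary there is 1 - 1.\<close>
    have "singular_simplex 0 X (singular_face 1 k \<sigma>)" if "singular_simplex 1 X \<sigma>" "k \<le> 1" for k
      using singular_simplex_singular_face[of 1 X \<sigma> k] that by simp
    then show ?thesis
      using True by (simp add: coboundary_def cocycle_algebra_def)
  next
    case False
    then show ?thesis
      by (auto simp: coboundary_def cocycle_algebra_def intro!: sum.neutral)
  qed
  moreover have "{p. unit_cochain X p \<noteq> (\<lambda>\<sigma>. 0)} \<subseteq> {0}"
    by (auto simp: cocycle_algebra_def)
  then have "finite {p. unit_cochain X p \<noteq> (\<lambda>\<sigma>. 0)}"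
    by (rule finite_subset) simp
  then have "unit_cochain X \<in> cochains X"
    unfolding cochains_def by (auto simp: cocycle_algebra_def)
  ultimately show ?thesis by (auto simp: cocycles_def)
qed

text \<open>In a total degree other than \<open>p + q\<close>, each summand has a factor outside its
  own degree.\<close>

lemma cup_degree:
  assumes "\<And>i. i \<noteq> p \<Longrightarrow> z i = (\<lambda>\<sigma>. 0)" "\<And>i. i \<noteq> q \<Longrightarrow> w i = (\<lambda>\<sigma>. 0)" "i \<noteq> p + q"
  shows "cup X z w i = (\<lambda>\<sigma>. 0)"
proof -
  have "z j \<sigma> * w (i - j) \<tau> = 0" if "j \<le> i" for j \<sigma> \<tau>
    using assms that by (cases "j = p") auto
  then show ?thesis by (auto simp: cup_def fun_eq_iff intro!: sum.neutral)
qed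

lemma front_face_self: "singular_simplex p X \<sigma> \<Longrightarrow> front_face p \<sigma> = \<sigma>"
  by (simp add: front_face_def singular_simplex_def extensional_restrict)

lemma back_face_self: "singular_simplex p X \<sigma> \<Longrightarrow> back_face p p \<sigma> = \<sigma>"
  by (simp add: back_face_def singular_simplex_def extensional_restrict)

text \<open>The standard 0-simplex is a single point, on which \<sigma> agrees with a constant map;
  this gives continuity.\<close>

lemma singular_simplex_0I:
  assumes "\<sigma> \<in> extensional (standard_simplex 0)"
    and "\<And>x. x \<in> standard_simplex 0 \<Longrightarrow> \<sigma> x \<in> topspace X"
  shows "singular_simplex 0 X \<sigma>"
proof -
  have "continuous_map (subtopology (powertop_real UNIV) (standard_simplex 0)) X
      (\<lambda>x. \<sigma> (\<lambda>j. if j = 0 then 1 else 0))"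
    using assms(2) by (simp add: standard_simplex_0)
  then have "continuous_map (subtopology (powertop_real UNIV) (standard_simplex 0)) X \<sigma>"
    by (rule continuous_map_eq) (simp add: standard_simplex_0)
  then show ?thesis using assms(1) by (simp add: singular_simplex_def)
qed

lemma singular_simplex_topspace:
  "singular_simplex p X \<sigma> \<Longrightarrow> x \<in> standard_simplex p \<Longrightarrow> \<sigma> x \<in> topspace X"
  by (auto simp: singular_simplex_def continuous_map_def)

lemma singular_simplex_front_0:
  assumes "singular_simplex p X \<sigma>"
  shows "singular_simplex 0 X (front_face 0 \<sigma>)"
proof (rule singular_simplex_0I)
  show "front_face 0 \<sigma> x \<in> topspace X" if "x \<in> standard_simplex 0" for x
    using that standard_simplex_mono[of 0 p] singular_simplex_topspace[OF assms]
    by (auto simp: front_face_def)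
qed (simp add: front_face_def)

lemma singular_simplex_back_0:
  assumes "singular_simplex p X \<sigma>"
  shows "singular_simplex 0 X (back_face p 0 \<sigma>)"
proof (rule singular_simplex_0I)
  show "back_face p 0 \<sigma> x \<in> topspace X" if "x \<in> standard_simplex 0" for x
  proof -
    \<comment> \<open>The back 0-face evaluates \<sigma> at the last vertex of the standard
      \<open>p\<close>-simplex.\<close>
    have "(\<lambda>i. if i < p then 0 else x (i - (p - 0))) = (\<lambda>i. if i = p then 1 else 0)"
      using that by (auto simp: standard_simplex_0 fun_eq_iff)
    moreover have "(\<lambda>i. if i = p then 1 else 0) \<in> standard_simplex p"
      by (simp add: standard_simplex_def)
    ultimately show ?thesis
      using that singular_simplex_topspace[OF assms] by (simp add: back_face_def)
  qed
qed (simp add: back_face_def)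

text \<open>Only the summand \<open>q = 0\<close> survives: there the front face is a vertex, where
  the unit is 1, and the back face is \<sigma> itself.\<close>

lemma cup_unit_left:
  assumes "z \<in> cochains X"
  shows "cup X (unit_cochain X) z = z"
proof (intro ext)
  fix p \<sigma>
  show "cup X (unit_cochain X) z p \<sigma> = z p \<sigma>"
  proof (cases "singular_simplex p X \<sigma>")
    case True
    then have "cup X (unit_cochain X) z p \<sigma> =
        (\<Sum>q\<le>p. unit_cochain X q (front_face q \<sigma>) * z (p - q) (back_face p (p - q) \<sigma>))"
      by (simp add: cup_def)
    also have "\<dots> = (\<Sum>q\<le>p. if q = 0 then z p \<sigma> else 0)"
      by (intro sum.cong)
        (auto simp: cocycle_algebra_def singular_simplex_front_0[OF True] back_face_self[OF True])
    finally show ?thesis by simp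
  qed (use assms in \<open>simp add: cup_def cochains_def\<close>)
qed

lemma cup_unit_right:
  assumes "z \<in> cochains X"
  shows "cup X z (unit_cochain X) = z"
proof (intro ext)
  fix p \<sigma>
  show "cup X z (unit_cochain X) p \<sigma> = z p \<sigma>"
  proof (cases "singular_simplex p X \<sigma>")
    case True
    then have "cup X z (unit_cochain X) p \<sigma> =
        (\<Sum>q\<le>p. z q (front_face q \<sigma>) * unit_cochain X (p - q) (back_face p (p - q) \<sigma>))"
      by (simp add: cup_def)
    also have "\<dots> = (\<Sum>q\<le>p. if q = p then z p \<sigma> else 0)"
      by (intro sum.cong)
        (auto simp: cocycle_algebra_def singular_simplex_back_0[OF True] front_face_self[OF True])
    finally show ?thesis by simp
  qed (use assms in \<open>simp add: cup_def cochains_def\<close>)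
qed

section \<open>Cohomology as a graded algebra\<close>

lemma cohomology_graded_unital: "graded_unital (cohomology_algebra X) (cohomology X)"
proof
  fix x y :: "('a, 'k::field) cochain set" and k :: 'k and p q :: nat
  let ?H = "cohomology_algebra X :: ('k, ('a, 'k) cochain set) module"
  show "x \<oplus>\<^bsub>?H\<^esub> y \<in> carrier ?H" if "x \<in> carrier ?H" "y \<in> carrier ?H"
    using that by (auto simp: cohomology_algebra_simps intro: cocycles_add)
  show "k \<odot>\<^bsub>?H\<^esub> x \<in> carrier ?H" if "x \<in> carrier ?H"
    using that by (auto simp: cohomology_algebra_simps intro: cocycles_scale)
  show "0 \<odot>\<^bsub>?H\<^esub> x = \<zero>\<^bsub>?H\<^esub>" if "x \<in> carrier ?H"
  proof -
    obtain z where z: "x = z +o coboundaries X"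
      using \<open>x \<in> carrier ?H\<close> unfolding cohomology_algebra_simps by blast
    have "(\<lambda>p \<sigma>. 0 * z p \<sigma>) = 0"
      by (simp add: fun_eq_iff)
    then show ?thesis
      unfolding z cohomology_algebra_simps by (simp only: coboundaries.coset_zero)
  qed
  show "cohomology X p \<subseteq> carrier ?H"
    by (auto simp: cohomology_algebra_simps cohomology_eq)
  show "x = \<zero>\<^bsub>?H\<^esub>" if xp: "x \<in> cohomology X p" and xq: "x \<in> cohomology X q" and "p \<noteq> q"
  proof -
    obtain z where z: "x = z +o coboundaries X" "\<And>i. i \<noteq> p \<Longrightarrow> z i = (\<lambda>\<sigma>. 0)"
      using xp unfolding cohomology_eq by blast
    obtain w where w: "x = w +o coboundaries X" "\<And>i. i \<noteq> q \<Longrightarrow> w i = (\<lambda>\<sigma>. 0)"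
      using xq unfolding cohomology_eq by blast
    \<comment> \<open>The representatives \<open>z\<close> and \<open>w\<close> are cohomologous and
      live in different degrees. So \<open>z\<close> is the degree \<open>p\<close> component of a
      coboundary, hence a coboundary itself.\<close>
    have "z - w \<in> coboundaries X"
      using z(1) w(1) by (metis coboundaries.coset_eq_iff)
    then have "degree_part p (z - w) \<in> coboundaries X"
      by (rule coboundaries_degree_part)
    moreover have "degree_part p (z - w) = z"
      using z(2) w(2) \<open>p \<noteq> q\<close> degree_part_eq[of p z] degree_part_eq_0[of q w p]
      by (simp add: degree_part_diff)
    ultimately have "z +o coboundaries X = 0 +o coboundaries X"
      unfolding coboundaries.coset_eq_iff by simp
    then show ?thesis
      using z(1) by (simp add: coboundaries.coset_zero cohomology_algebra_simps)
  qed
  show "\<one>\<^bsub>?H\<^esub> \<in> cohomology X 0"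
  proof -
    have "unit_cochain X q = (\<lambda>\<sigma>. 0)" if "q \<noteq> 0" for q
      using that by (simp add: cocycle_algebra_def)
    then show ?thesis
      unfolding cohomology_eq cohomology_algebra_simps using unit_cochain_cocycle by blast
  qed
qed

lemma cohomology_mult_coset:
  assumes "(z +o coboundaries X) \<otimes>\<^bsub>cohomology_algebra X\<^esub> (w +o coboundaries X)
    \<in> carrier (cohomology_algebra X)"
  shows "(z +o coboundaries X) \<otimes>\<^bsub>cohomology_algebra X\<^esub> (w +o coboundaries X)
    = cup X z w +o coboundaries X"
proof -
  let ?J = "(z +o coboundaries X) \<times> (w +o coboundaries X)"
  obtain c where "(z +o coboundaries X) \<otimes>\<^bsub>cohomology_algebra X\<^esub> (w +o coboundaries X)
      = c +o coboundaries X"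
    using assms unfolding cohomology_algebra_simps(1) by blast
  then have c: "(\<Union>x\<in>?J. cup X (fst x) (snd x) +o coboundaries X) = c +o coboundaries X"
    unfolding cohomology_algebra_simps(5) .
  have "(z, w) \<in> ?J"
    by (simp add: coboundaries.self_mem_coset)
  from coboundaries.Union_cosets_eq[OF c this] show ?thesis
    unfolding cohomology_algebra_simps(5) by simp
qed

text \<open>Closure of products of homogeneous classes is inherited from the tensor power. With it,
  products are cup products of representatives, and the unit laws and degrees are checked on
  cochains.\<close>

lemma cohomology_graded_algebra:
  fixes X :: "'a topology"
  assumes "ring (cohomology_tensor_power X n :: ('k::field, (('a, 'k) cochain set list \<Rightarrow>\<^sub>0 'k) set) module)"
    and "n > 0"
  shows "graded_algebra (cohomology_algebra X :: ('k, ('a, 'k) cochain set) module) (cohomology X)"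
proof -
  let ?H = "cohomology_algebra X :: ('k, ('a, 'k) cochain set) module"
  interpret graded_unital ?H "cohomology X"
    by (rule cohomology_graded_unital)
  note closed = mult_closed_of_ring_tensor_power[OF assms]
  show ?thesis
  proof
    fix x y :: "('a, 'k) cochain set" and p q :: nat
    assume x: "x \<in> cohomology X p"
    then obtain z where z: "x = z +o coboundaries X" "z \<in> cocycles X" "\<And>i. i \<noteq> p \<Longrightarrow> z i = (\<lambda>\<sigma>. 0)"
      unfolding cohomology_eq by blast
    show "\<one>\<^bsub>?H\<^esub> \<otimes>\<^bsub>?H\<^esub> x = x" "x \<otimes>\<^bsub>?H\<^esub> \<one>\<^bsub>?H\<^esub> = x"
      using cohomology_mult_coset[where X = X and z = "unit_cochain X" and w = z]
        cohomology_mult_coset[where X = X and z = z and w = "unit_cochain X"]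
        closed[OF one_degree x] closed[OF x one_degree] z(2)
      unfolding z(1) cohomology_algebra_simps(3)
      by (metis cocycles_cochains cup_unit_left, metis cocycles_cochains cup_unit_right)
    assume y: "y \<in> cohomology X q"
    then obtain w where w: "y = w +o coboundaries X" "\<And>i. i \<noteq> q \<Longrightarrow> w i = (\<lambda>\<sigma>. 0)"
      unfolding cohomology_eq by blast
    have c: "x \<otimes>\<^bsub>?H\<^esub> y = cup X z w +o coboundaries X"
      using closed[OF x y] unfolding z(1) w(1) by (rule cohomology_mult_coset)
    \<comment> \<open>Closure yields a cocycle \<open>c\<close> differing from the cup product by a
      coboundary. As the cup product is concentrated in degree \<open>p + q\<close>, that component
      of \<open>c\<close> is a homogeneous representative.\<close>
    then obtain c where c': "c \<in> cocycles X" "cup X z w +o coboundaries X = c +o coboundaries X"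
      using closed[OF x y] by (auto simp: cohomology_algebra_simps(1))
    have "degree_part (p + q) (cup X z w) = cup X z w"
      using z(3) w(2) cup_degree by (intro degree_part_eq) blast
    then have "cup X z w - degree_part (p + q) c \<in> coboundaries X"
      using coboundaries_degree_part[of "cup X z w - c" X "p + q"] c'(2)
      by (simp add: coboundaries.coset_eq_iff degree_part_diff)
    then have "x \<otimes>\<^bsub>?H\<^esub> y = degree_part (p + q) c +o coboundaries X"
      unfolding c by (simp add: coboundaries.coset_eq_iff)
    then show "x \<otimes>\<^bsub>?H\<^esub> y \<in> cohomology X (p + q)"
      unfolding cohomology_eq using cocycles_degree_part[OF c'(1)] by (auto simp: degree_part_def)
  qed
qed

section \<open>The congruence in the tensor power of cohomology\<close>

theorem lemma3p1:
  fixes X :: "'a topology"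
    and a b :: "('a, 'k::field) cochain set"
    and p q n :: nat
    and H :: "('k, ('a, 'k) cochain set) module"
    and T (structure)
    and slot :: "nat \<Rightarrow> ('a, 'k) cochain set \<Rightarrow> (('a, 'k) cochain set list \<Rightarrow>\<^sub>0 'k) set"
  assumes H: "H = cohomology_algebra X"
    and T: "T = cohomology_tensor_power X n"
    and slot: "slot = in_position H n"
    and a: "a \<in> cohomology X p"
    and b: "b \<in> cohomology X q"
    and n: "n \<ge> 2"
  shows "((slot 1 b \<ominus> slot 2 b) \<otimes> foldr (\<otimes>) (map (\<lambda>i. slot 1 a \<ominus> slot i a) [2..<n + 1]) \<one>)
           \<ominus> ((-1) ^ (n + 1)) \<odot>
               (pure_tensor H (b # a # replicate (n - 2) a) \<oplus>
                ((-1) ^ (p * q)) \<odot> pure_tensor H (a # b # replicate (n - 2) a))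
         \<in> Idl {slot 1 (a \<otimes>\<^bsub>H\<^esub> a), slot 1 (b \<otimes>\<^bsub>H\<^esub> a), slot 2 (b \<otimes>\<^bsub>H\<^esub> a)}"
  unfolding genideal_def
\<comment> \<open>The generated ideal is the intersection of all ideals containing the generators,
  so the claim is proved for each such \<open>J\<close>; \<open>ideal J T\<close> also supplies the
  ring axioms of \<open>T\<close>.\<close>
proof (intro InterI, clarify)
  fix J
  assume J: "ideal J T"
    and mem: "{slot 1 (a \<otimes>\<^bsub>H\<^esub> a), slot 1 (b \<otimes>\<^bsub>H\<^esub> a), slot 2 (b \<otimes>\<^bsub>H\<^esub> a)} \<subseteq> J"
  have ring: "ring (cohomology_tensor_power X n :: ('k, (('a, 'k) cochain set list \<Rightarrow>\<^sub>0 'k) set) module)"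
    using J T by (simp add: ideal_def)
  have "graded_algebra (cohomology_algebra X :: ('k, ('a, 'k) cochain set) module) (cohomology X)"
    using n by (intro cohomology_graded_algebra[OF ring]) simp
  then interpret graded_tensor_ring "cohomology_algebra X :: ('k, ('a, 'k) cochain set) module" "cohomology X" n
    using ring by (intro graded_tensor_ring.intro)
  show "((slot 1 b \<ominus> slot 2 b) \<otimes> foldr (\<otimes>) (map (\<lambda>i. slot 1 a \<ominus> slot i a) [2..<n + 1]) \<one>)
           \<ominus> ((-1) ^ (n + 1)) \<odot>
               (pure_tensor H (b # a # replicate (n - 2) a) \<oplus>
                ((-1) ^ (p * q)) \<odot> pure_tensor H (a # b # replicate (n - 2) a)) \<in> J"
    using mult_differences_in_ideal[OF a b n] J mem unfolding H T slot by blast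
qed

end
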